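(* Let $(M,\mathcal{H},\langle\cdot,\cdot\rangle)$ be a sub-Riemannian manifold satisfying Hörmander's condition. Suppose $(\cdot,\cdot)_1$ and $(\cdot,\cdot)_2$ are compatible Riemannian metrics on $M$, and for $i=1,2$ let $\mathcal{V}_i$ be the orthogonal complement of $\mathcal{H}$ in $TM$ with respect to $(\cdot,\cdot)_i$, and let $\mathcal{L}_i$ be the horizontal sub-Laplacian corresponding to $(\cdot,\cdot)_i$. If $\mathcal{V}_1=\mathcal{V}_2$, then $\mathcal{L}_1=\mathcal{L}_2$.
   Context: $M$ is a connected smooth manifold of dimension $d$; $\mathcal{H}\subset TM$ is a smooth sub-bundle of rank $m\le d$ whose fibers carry inner products $\langle\cdot,\cdot\rangle_q$ varying smoothly in $q$; $(M,\mathcal{H},\langle\cdot,\cdot\rangle)$ is called a sub-Riemannian manifold. Hörmander's condition: sections of $\mathcal{H}$ together with their iterated Lie brackets span $T_qM$ at every $q\in M$. The bundle map $\beta:T^{\ast}M\to TM$, with image $\mathcal{H}$, is defined by $\langle\beta_q(p),v\rangle_q=p(v)$ for all $p\in T^{\ast}_qM$, $v\in\mathcal{H}_q$. The Hamiltonian is $H(q,p)=\frac12\langle\beta_q(p),\beta_q(p)\rangle_q=\frac12p(\beta_q(p))$, and $\Phi_t$ is the (locally defined) flow on $T^{\ast}M$ of Hamilton's equations, in canonical coordinates $\dot q^i=\partial H/\partial p_i$, $\dot p_i=-\partial H/\partial q^i$. A Riemannian metric $(\cdot,\cdot)$ on $M$ is compatible if its restriction to $\mathcal{H}_q\times\mathcal{H}_q$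 is $\langle\cdot,\cdot\rangle_q$ for all $q$; its bundle map is $g:TM\to T^{\ast}M$, $g(v)=(\cdot,v)$. $\mathcal{S}^{\mathcal{H}}_x=\{v\in\mathcal{H}_x:\langle v,v\rangle_x=1\}$ and $\mathbb{U}_x$ is the rotationally invariant probability measure on it. The horizontal sub-Laplacian corresponding to $(\cdot,\cdot)$ is, for $f\in C_c^\infty(M)$, $$\mathcal{L}f(x)=\int_{\mathcal{S}^{\mathcal{H}}_x}\Big\{\frac{d}{dt}\Big|_{0}\frac{d}{ds}\Big|_{0}f\big(\Phi_{t+s}(x,g(v))\big)\Big\}\,\mathbb{U}_x(dv),$$ where a function $f$ on $M$ is identified with the function $(x,p)\mapsto f(x)$ on $T^{\ast}M$. *)

theory Defs
  imports "HOL-Analysis.Analysis" "HOL-Library.Function_Algebras"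
begin

(* Tangent vectors are functionals on functions, so the function type is given its pointwise
   real vector space structure (addition comes from Function_Algebras). *)

instantiation "fun" :: (type, real_vector) real_vector
begin

definition scaleR_fun :: "real \<Rightarrow> ('a \<Rightarrow> 'b) \<Rightarrow> 'a \<Rightarrow> 'b" where
  "scaleR_fun c f = (\<lambda>x. c *\<^sub>R f x)"

instance
  by standard (simp_all add: scaleR_fun_def fun_eq_iff scaleR_add_right scaleR_add_left)

end

(* Only meant for open S. *)

primrec C_k_on :: "nat \<Rightarrow> 'e::real_normed_vector set \<Rightarrow> ('e \<Rightarrow> 'f::real_normed_vector) \<Rightarrow> bool" where
  "C_k_on 0 S f \<longleftrightarrow> continuous_on S f"
| "C_k_on (Suc k) S f \<longleftrightarrow>
     (\<forall>x\<in>S. f differentiable (at x)) \<and> (\<forall>v. C_k_on k S (\<lambda>x. frechet_derivative f (at x) v))"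

definition smooth_on :: "'e::real_normed_vector set \<Rightarrow> ('e \<Rightarrow> 'f::real_normed_vector) \<Rightarrow> bool" where
  "smooth_on S f \<longleftrightarrow> (\<forall>k. C_k_on k S f)"

definition partial_deriv :: "'d::finite \<Rightarrow> (real^'d \<Rightarrow> real) \<Rightarrow> real^'d \<Rightarrow> real" where
  "partial_deriv i F x = deriv (\<lambda>h. F (x + h *\<^sub>R axis i 1)) 0"

type_synonym ('a, 'd) chart = "'a set \<times> ('a \<Rightarrow> real^'d)"

(* The points of the manifold are topspace (mtop M); functions, vector fields etc. on the manifold
   are total functions whose values at other elements of 'a are irrelevant. The dimension is
   CARD('d), and charts M is some smooth atlas, not necessarily a maximal one. *)

record ('a, 'd::finite) manifold =
  mtop :: "'a topology"
  charts :: "('a, 'd) chart set"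

definition smooth_manifold :: "('a, 'd::finite) manifold \<Rightarrow> bool" where
  "smooth_manifold M \<longleftrightarrow>
     Hausdorff_space (mtop M) \<and> second_countable (mtop M) \<and>
     (\<Union>(U, \<phi>)\<in>charts M. U) = topspace (mtop M) \<and>
     (\<forall>(U, \<phi>)\<in>charts M.
        openin (mtop M) U \<and> open (\<phi> ` U) \<and>
        homeomorphic_map (subtopology (mtop M) U) (top_of_set (\<phi> ` U)) \<phi>) \<and>
     (\<forall>(U, \<phi>)\<in>charts M. \<forall>(V, \<psi>)\<in>charts M.
        smooth_on (\<phi> ` (U \<inter> V)) (\<lambda>y. \<psi> (inv_into U \<phi> y)))"

definition smooth_fun_on ::
  "('a, 'd::finite) manifold \<Rightarrow> 'a set \<Rightarrow> ('a \<Rightarrow> 'f::real_normed_vector) \<Rightarrow> bool" where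
  "smooth_fun_on M W f \<longleftrightarrow>
     (\<forall>(U, \<phi>)\<in>charts M. smooth_on (\<phi> ` (U \<inter> W)) (\<lambda>y. f (inv_into U \<phi> y)))"

definition C_inf :: "('a, 'd::finite) manifold \<Rightarrow> ('a \<Rightarrow> real) set" where
  "C_inf M = {f. smooth_fun_on M (topspace (mtop M)) f}"

definition C_inf_c :: "('a, 'd::finite) manifold \<Rightarrow> ('a \<Rightarrow> real) set" where
  "C_inf_c M = {f \<in> C_inf M.
     compactin (mtop M) (mtop M closure_of {x \<in> topspace (mtop M). f x \<noteq> 0})}"

type_synonym 'a tangent = "('a \<Rightarrow> real) \<Rightarrow> real"
type_synonym 'a cotangent = "'a tangent \<Rightarrow> real"

(* Derivations of C_inf M at q, extended by 0 to functions outside C_inf M. A derivation does not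
   see the values of f outside the manifold: if h vanishes on the manifold and k is the
   indicator function of the manifold, then h * k = 0 everywhere, and the Leibniz rule gives
   D h = 0. *)

definition tangent_space :: "('a, 'd::finite) manifold \<Rightarrow> 'a \<Rightarrow> 'a tangent set" where
  "tangent_space M q = {D.
     (\<forall>f. f \<notin> C_inf M \<longrightarrow> D f = 0) \<and>
     (\<forall>f\<in>C_inf M. \<forall>g\<in>C_inf M. D (\<lambda>x. f x + g x) = D f + D g) \<and>
     (\<forall>c. \<forall>f\<in>C_inf M. D (\<lambda>x. c * f x) = c * D f) \<and>
     (\<forall>f\<in>C_inf M. \<forall>g\<in>C_inf M. D (\<lambda>x. f x * g x) = f q * D g + g q * D f)}"

definition cotangent_space :: "('a, 'd::finite) manifold \<Rightarrow> 'a \<Rightarrow> 'a cotangent set" where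
  "cotangent_space M q = {p.
     (\<forall>v. v \<notin> tangent_space M q \<longrightarrow> p v = 0) \<and>
     (\<forall>v\<in>tangent_space M q. \<forall>w\<in>tangent_space M q. p (v + w) = p v + p w) \<and>
     (\<forall>c. \<forall>v\<in>tangent_space M q. p (c *\<^sub>R v) = c * p v)}"

definition coord_vector ::
  "('a, 'd::finite) manifold \<Rightarrow> ('a, 'd) chart \<Rightarrow> 'd \<Rightarrow> 'a \<Rightarrow> 'a tangent" where
  "coord_vector M c i q = (case c of (U, \<phi>) \<Rightarrow>
     (\<lambda>f. if f \<in> C_inf M then partial_deriv i (\<lambda>y. f (inv_into U \<phi> y)) (\<phi> q) else 0))"

(* The covector at q with canonical coordinates xi in the given chart. *)

definition coord_covector ::
  "('a, 'd::finite) manifold \<Rightarrow> ('a, 'd) chart \<Rightarrow> 'a \<Rightarrow> real^'d \<Rightarrow> 'a cotangent" where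
  "coord_covector M c q \<xi> =
     (THE p. p \<in> cotangent_space M q \<and> (\<forall>i. p (coord_vector M c i q) = \<xi> $ i))"

definition smooth_vector_field ::
  "('a, 'd::finite) manifold \<Rightarrow> 'a set \<Rightarrow> ('a \<Rightarrow> 'a tangent) \<Rightarrow> bool" where
  "smooth_vector_field M W X \<longleftrightarrow>
     (\<forall>q\<in>W. X q \<in> tangent_space M q) \<and>
     (\<forall>(U, \<phi>)\<in>charts M. \<exists>\<xi> :: 'a \<Rightarrow> real^'d.
        smooth_on (\<phi> ` (U \<inter> W)) (\<lambda>y. \<xi> (inv_into U \<phi> y)) \<and>
        (\<forall>q\<in>U \<inter> W. X q = (\<Sum>i\<in>UNIV. \<xi> q $ i *\<^sub>R coord_vector M (U, \<phi>) i q)))"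

definition smooth_section ::
  "('a, 'd::finite) manifold \<Rightarrow> ('a \<Rightarrow> 'a tangent set) \<Rightarrow> 'a set \<Rightarrow> ('a \<Rightarrow> 'a tangent) \<Rightarrow> bool" where
  "smooth_section M \<H> W X \<longleftrightarrow> smooth_vector_field M W X \<and> (\<forall>q\<in>W. X q \<in> \<H> q)"

definition smooth_subbundle ::
  "('a, 'd::finite) manifold \<Rightarrow> nat \<Rightarrow> ('a \<Rightarrow> 'a tangent set) \<Rightarrow> bool" where
  "smooth_subbundle M m \<H> \<longleftrightarrow>
     (\<forall>q\<in>topspace (mtop M). \<exists>W. openin (mtop M) W \<and> q \<in> W \<and>
        (\<exists>X :: nat \<Rightarrow> 'a \<Rightarrow> 'a tangent.
           (\<forall>i<m. smooth_vector_field M W (X i)) \<and>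
           (\<forall>r\<in>W. inj_on (\<lambda>i. X i r) {..<m} \<and> independent ((\<lambda>i. X i r) ` {..<m}) \<and>
                   span ((\<lambda>i. X i r) ` {..<m}) = \<H> r)))"

definition lie_bracket ::
  "('a \<Rightarrow> 'a tangent) \<Rightarrow> ('a \<Rightarrow> 'a tangent) \<Rightarrow> 'a \<Rightarrow> 'a tangent" where
  "lie_bracket X Y q = (\<lambda>f. X q (\<lambda>r. Y r f) - Y q (\<lambda>r. X r f))"

inductive_set iterated_brackets ::
  "('a, 'd::finite) manifold \<Rightarrow> ('a \<Rightarrow> 'a tangent set) \<Rightarrow> ('a \<Rightarrow> 'a tangent) set"
  for M :: "('a, 'd::finite) manifold" and \<H> :: "'a \<Rightarrow> 'a tangent set" where
  horizontal: "smooth_section M \<H> (topspace (mtop M)) X \<Longrightarrow> X \<in> iterated_brackets M \<H>"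
| bracket: "X \<in> iterated_brackets M \<H> \<Longrightarrow> Y \<in> iterated_brackets M \<H> \<Longrightarrow>
    lie_bracket X Y \<in> iterated_brackets M \<H>"

definition hoermander_condition ::
  "('a, 'd::finite) manifold \<Rightarrow> ('a \<Rightarrow> 'a tangent set) \<Rightarrow> bool" where
  "hoermander_condition M \<H> \<longleftrightarrow>
     (\<forall>q\<in>topspace (mtop M). span {X q | X. X \<in> iterated_brackets M \<H>} = tangent_space M q)"

definition inner_product_on :: "'v::real_vector set \<Rightarrow> ('v \<Rightarrow> 'v \<Rightarrow> real) \<Rightarrow> bool" where
  "inner_product_on V b \<longleftrightarrow>
     (\<forall>u\<in>V. \<forall>v\<in>V. b u v = b v u) \<and>
     (\<forall>u\<in>V. \<forall>v\<in>V. \<forall>w\<in>V. b (u + v) w = b u w + b v w) \<and>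
     (\<forall>c. \<forall>u\<in>V. \<forall>w\<in>V. b (c *\<^sub>R u) w = c * b u w) \<and>
     (\<forall>u\<in>V. u \<noteq> 0 \<longrightarrow> b u u > 0)"

definition smooth_fibre_metric ::
  "('a, 'd::finite) manifold \<Rightarrow> ('a \<Rightarrow> 'a tangent set) \<Rightarrow>
   ('a \<Rightarrow> 'a tangent \<Rightarrow> 'a tangent \<Rightarrow> real) \<Rightarrow> bool" where
  "smooth_fibre_metric M E b \<longleftrightarrow>
     (\<forall>q\<in>topspace (mtop M). inner_product_on (E q) (b q)) \<and>
     (\<forall>W X Y. openin (mtop M) W \<and> smooth_section M E W X \<and> smooth_section M E W Y \<longrightarrow>
        smooth_fun_on M W (\<lambda>q. b q (X q) (Y q)))"

definition riemannian_metric ::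
  "('a, 'd::finite) manifold \<Rightarrow> ('a \<Rightarrow> 'a tangent \<Rightarrow> 'a tangent \<Rightarrow> real) \<Rightarrow> bool" where
  "riemannian_metric M G \<longleftrightarrow> smooth_fibre_metric M (tangent_space M) G"

(* In the definitions below, \<H> q is the fibre of the horizontal bundle and h q the inner product
   on it. *)

definition sub_riemannian_manifold ::
  "('a, 'd::finite) manifold \<Rightarrow> nat \<Rightarrow> ('a \<Rightarrow> 'a tangent set) \<Rightarrow>
   ('a \<Rightarrow> 'a tangent \<Rightarrow> 'a tangent \<Rightarrow> real) \<Rightarrow> bool" where
  "sub_riemannian_manifold M m \<H> h \<longleftrightarrow>
     smooth_manifold M \<and> connected_space (mtop M) \<and> m \<le> CARD('d) \<and>
     smooth_subbundle M m \<H> \<and> smooth_fibre_metric M \<H> h"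

definition compatible_metric ::
  "('a, 'd::finite) manifold \<Rightarrow> ('a \<Rightarrow> 'a tangent set) \<Rightarrow>
   ('a \<Rightarrow> 'a tangent \<Rightarrow> 'a tangent \<Rightarrow> real) \<Rightarrow> ('a \<Rightarrow> 'a tangent \<Rightarrow> 'a tangent \<Rightarrow> real) \<Rightarrow> bool" where
  "compatible_metric M \<H> h G \<longleftrightarrow>
     riemannian_metric M G \<and>
     (\<forall>q\<in>topspace (mtop M). \<forall>v\<in>\<H> q. \<forall>w\<in>\<H> q. G q v w = h q v w)"

definition orth_complement ::
  "('a, 'd::finite) manifold \<Rightarrow> ('a \<Rightarrow> 'a tangent set) \<Rightarrow>
   ('a \<Rightarrow> 'a tangent \<Rightarrow> 'a tangent \<Rightarrow> real) \<Rightarrow> 'a \<Rightarrow> 'a tangent set" where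
  "orth_complement M \<H> G q = {w \<in> tangent_space M q. \<forall>v\<in>\<H> q. G q w v = 0}"

definition metric_flat ::
  "('a, 'd::finite) manifold \<Rightarrow> ('a \<Rightarrow> 'a tangent \<Rightarrow> 'a tangent \<Rightarrow> real) \<Rightarrow>
   'a \<Rightarrow> 'a tangent \<Rightarrow> 'a cotangent" where
  "metric_flat M G q v = (\<lambda>w. if w \<in> tangent_space M q then G q w v else 0)"

definition beta ::
  "('a \<Rightarrow> 'a tangent set) \<Rightarrow> ('a \<Rightarrow> 'a tangent \<Rightarrow> 'a tangent \<Rightarrow> real) \<Rightarrow>
   'a \<Rightarrow> 'a cotangent \<Rightarrow> 'a tangent" where
  "beta \<H> h q p = (THE u. u \<in> \<H> q \<and> (\<forall>v\<in>\<H> q. h q u v = p v))"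

definition hamiltonian ::
  "('a \<Rightarrow> 'a tangent set) \<Rightarrow> ('a \<Rightarrow> 'a tangent \<Rightarrow> 'a tangent \<Rightarrow> real) \<Rightarrow>
   'a \<times> 'a cotangent \<Rightarrow> real" where
  "hamiltonian \<H> h z = (case z of (q, p) \<Rightarrow> 1 / 2 * h q (beta \<H> h q p) (beta \<H> h q p))"

definition coord_hamiltonian ::
  "('a, 'd::finite) manifold \<Rightarrow> ('a \<Rightarrow> 'a tangent set) \<Rightarrow>
   ('a \<Rightarrow> 'a tangent \<Rightarrow> 'a tangent \<Rightarrow> real) \<Rightarrow> ('a, 'd) chart \<Rightarrow> real^'d \<Rightarrow> real^'d \<Rightarrow> real" where
  "coord_hamiltonian M \<H> h c y \<xi> = (case c of (U, \<phi>) \<Rightarrow>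
     hamiltonian \<H> h (inv_into U \<phi> y, coord_covector M c (inv_into U \<phi> y) \<xi>))"

(* Continuity of the base curve makes the local coordinates of \<gamma> s meaningful for s near t. *)

definition hamiltonian_curve ::
  "('a, 'd::finite) manifold \<Rightarrow> ('a \<Rightarrow> 'a tangent set) \<Rightarrow>
   ('a \<Rightarrow> 'a tangent \<Rightarrow> 'a tangent \<Rightarrow> real) \<Rightarrow> real set \<Rightarrow> (real \<Rightarrow> 'a \<times> 'a cotangent) \<Rightarrow> bool" where
  "hamiltonian_curve M \<H> h J \<gamma> \<longleftrightarrow>
     continuous_map (top_of_set J) (mtop M) (\<lambda>t. fst (\<gamma> t)) \<and>
     (\<forall>t\<in>J. snd (\<gamma> t) \<in> cotangent_space M (fst (\<gamma> t))) \<and>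
     (\<forall>t\<in>J. \<forall>(U, \<phi>)\<in>charts M. fst (\<gamma> t) \<in> U \<longrightarrow>
        (let q = (\<lambda>s. \<phi> (fst (\<gamma> s)));
             p = (\<lambda>s. \<chi> i. snd (\<gamma> s) (coord_vector M (U, \<phi>) i (fst (\<gamma> s))));
             \<eta> = coord_hamiltonian M \<H> h (U, \<phi>)
         in \<forall>i. ((\<lambda>s. q s $ i) has_real_derivative
                   partial_deriv i (\<lambda>\<xi>. \<eta> (q t) \<xi>) (p t)) (at t) \<and>
                ((\<lambda>s. p s $ i) has_real_derivative
                   - partial_deriv i (\<lambda>y. \<eta> y (p t)) (q t)) (at t)))"

(* The value at time t of the unique maximal integral curve starting at z; a meaningless value
   if that curve does not exist up to time t. *)

definition hamiltonian_flow ::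
  "('a, 'd::finite) manifold \<Rightarrow> ('a \<Rightarrow> 'a tangent set) \<Rightarrow>
   ('a \<Rightarrow> 'a tangent \<Rightarrow> 'a tangent \<Rightarrow> real) \<Rightarrow> real \<Rightarrow> 'a \<times> 'a cotangent \<Rightarrow> 'a \<times> 'a cotangent" where
  "hamiltonian_flow M \<H> h t z =
     (THE w. \<exists>J \<gamma>. open J \<and> is_interval J \<and> 0 \<in> J \<and> t \<in> J \<and>
        hamiltonian_curve M \<H> h J \<gamma> \<and> \<gamma> 0 = z \<and> \<gamma> t = w)"

definition unit_sphere ::
  "('a \<Rightarrow> 'a tangent set) \<Rightarrow> ('a \<Rightarrow> 'a tangent \<Rightarrow> 'a tangent \<Rightarrow> real) \<Rightarrow> 'a \<Rightarrow> 'a tangent set" where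
  "unit_sphere \<H> h x = {v \<in> \<H> x. h x v v = 1}"

(* Borel sets for the metric that the inner product induces on the sphere. *)

definition sphere_borel_sets ::
  "('a \<Rightarrow> 'a tangent set) \<Rightarrow> ('a \<Rightarrow> 'a tangent \<Rightarrow> 'a tangent \<Rightarrow> real) \<Rightarrow> 'a \<Rightarrow> 'a tangent set set" where
  "sphere_borel_sets \<H> h x = sigma_sets (unit_sphere \<H> h x)
     {V. V \<subseteq> unit_sphere \<H> h x \<and>
         (\<forall>v\<in>V. \<exists>e>0. \<forall>w\<in>unit_sphere \<H> h x. sqrt (h x (w - v) (w - v)) < e \<longrightarrow> w \<in> V)}"

(* All linear isometries of the fibre, not only the orientation-preserving ones: on a fibre of
   dimension 1 the latter would not determine the invariant measure. *)

definition rotations ::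
  "('a \<Rightarrow> 'a tangent set) \<Rightarrow> ('a \<Rightarrow> 'a tangent \<Rightarrow> 'a tangent \<Rightarrow> real) \<Rightarrow> 'a \<Rightarrow>
   ('a tangent \<Rightarrow> 'a tangent) set" where
  "rotations \<H> h x = {R. R ` \<H> x = \<H> x \<and>
     (\<forall>v\<in>\<H> x. \<forall>w\<in>\<H> x. R (v + w) = R v + R w) \<and>
     (\<forall>c. \<forall>v\<in>\<H> x. R (c *\<^sub>R v) = c *\<^sub>R R v) \<and>
     (\<forall>v\<in>\<H> x. \<forall>w\<in>\<H> x. h x (R v) (R w) = h x v w)}"

definition uniform_sphere_measure ::
  "('a \<Rightarrow> 'a tangent set) \<Rightarrow> ('a \<Rightarrow> 'a tangent \<Rightarrow> 'a tangent \<Rightarrow> real) \<Rightarrow> 'a \<Rightarrow> 'a tangent measure" where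
  "uniform_sphere_measure \<H> h x = (THE \<mu>.
     space \<mu> = unit_sphere \<H> h x \<and> sets \<mu> = sphere_borel_sets \<H> h x \<and>
     emeasure \<mu> (space \<mu>) = 1 \<and>
     (\<forall>R\<in>rotations \<H> h x. \<forall>B\<in>sets \<mu>. emeasure \<mu> (R ` B) = emeasure \<mu> B))"

definition horizontal_sub_laplacian ::
  "('a, 'd::finite) manifold \<Rightarrow> ('a \<Rightarrow> 'a tangent set) \<Rightarrow>
   ('a \<Rightarrow> 'a tangent \<Rightarrow> 'a tangent \<Rightarrow> real) \<Rightarrow> ('a \<Rightarrow> 'a tangent \<Rightarrow> 'a tangent \<Rightarrow> real) \<Rightarrow>
   ('a \<Rightarrow> real) \<Rightarrow> 'a \<Rightarrow> real" where
  "horizontal_sub_laplacian M \<H> h G f x =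
     (LINT v:unit_sphere \<H> h x | uniform_sphere_measure \<H> h x.
        deriv (\<lambda>t. deriv (\<lambda>s. f (fst (hamiltonian_flow M \<H> h (t + s) (x, metric_flat M G x v)))) 0) 0)"

end

(* A covector of the form g(v) with v horizontal vanishes on the orthogonal complement of \<H> and
   agrees with the sub-Riemannian inner product on \<H>. These two conditions determine it, because
   the tangent space is the sum of \<H> and the complement. So the two metrics have the same flat map
   on \<H>, and the sub-Laplacian depends on the metric only through this map. *)

theory Submission
  imports Defs
begin

lemma inner_product_on_commute:
  "inner_product_on V b \<Longrightarrow> u \<in> V \<Longrightarrow> v \<in> V \<Longrightarrow> b u v = b v u"
  unfolding inner_product_on_def by simp

lemma inner_product_on_scale:
  "inner_product_on V b \<Longrightarrow> u \<in> V \<Longrightarrow> z \<in> V \<Longrightarrow> b (c *\<^sub>R u) z = c * b u z"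
  unfolding inner_product_on_def by simp

lemma inner_product_on_add:
  "inner_product_on V b \<Longrightarrow> u \<in> V \<Longrightarrow> v \<in> V \<Longrightarrow> z \<in> V \<Longrightarrow> b (u + v) z = b u z + b v z"
  unfolding inner_product_on_def by simp

text \<open>Gram-Schmidt, by induction on \<open>B\<close>: the part \<open>e\<close> of the new
  generator orthogonal to \<open>span B\<close> extends the projection \<open>u\<close> of
  \<open>w\<close> by one term along \<open>e\<close>. The bilinear form is controlled on
  \<open>V\<close> only, so every vector has to be shown to lie in \<open>V\<close>.\<close>

lemma orthogonal_decomposition:
  assumes "subspace V" and "inner_product_on V b" and "finite B" and "B \<subseteq> V" and "w \<in> V"
  shows "\<exists>u\<in>span B. \<forall>v\<in>span B. b (w - u) v = 0"
  using assms(3,4,5)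
proof (induction B arbitrary: w rule: finite_induct)
  case empty
  \<comment> \<open>Linearity is given in the first argument only, so the zero vector is moved there
    by symmetry.\<close>
  have "b w 0 = b 0 w"
    using inner_product_on_commute[OF assms(2)] empty subspace_0[OF assms(1)] by simp
  also have "\<dots> = 0"
    using inner_product_on_scale[OF assms(2), of w w 0] empty by simp
  finally show ?case by simp
next
  case (insert a B)
  have sym: "b u v = b v u" if "u \<in> V" "v \<in> V" for u v
    using inner_product_on_commute[OF assms(2) that] .
  have add: "b (u + v) z = b u z + b v z" if "u \<in> V" "v \<in> V" "z \<in> V" for u v z
    using inner_product_on_add[OF assms(2) that] .
  have scale: "b (c *\<^sub>R u) z = c * b u z" if "u \<in> V" "z \<in> V" for c u z
    using inner_product_on_scale[OF assms(2) that] .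
  have pos: "b u u > 0" if "u \<in> V" "u \<noteq> 0" for u
    using assms(2) that unfolding inner_product_on_def by simp
  have diff: "b (u - v) z = b u z - b v z" if "u \<in> V" "v \<in> V" "z \<in> V" for u v z
    using add[OF subspace_diff[OF assms(1) that(1,2)] that(2,3)] by simp
  have BV: "span B \<subseteq> V"
    using insert.prems assms(1) by (simp add: span_minimal)
  \<comment> \<open>The induction hypothesis is used twice, for \<open>a\<close> and for
    \<open>w\<close>; this is why \<open>w\<close> is kept arbitrary.\<close>
  from insert obtain p where p: "p \<in> span B" "\<And>v. v \<in> span B \<Longrightarrow> b (a - p) v = 0"
    by blast
  from insert obtain u where u: "u \<in> span B" "\<And>v. v \<in> span B \<Longrightarrow> b (w - u) v = 0"
    by blast
  show ?case
  proof (cases "a = p")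
    \<comment> \<open>Here \<open>a\<close> already lies in \<open>span B\<close>, so the span does
      not grow and \<open>u\<close> still works.\<close>
    case True
    then show ?thesis
      using u p(1) by (metis span_redundant)
  next
    case False
    define e where "e = a - p"
    \<comment> \<open>The Fourier coefficient of \<open>w - u\<close> along \<open>e\<close>, chosen
      to make the new remainder orthogonal to \<open>e\<close>.\<close>
    define c where "c = b (w - u) e / b e e"
    have e: "e \<in> V" "b e e > 0"
      using False p(1) BV insert.prems(1) subspace_diff[OF assms(1), of a p] pos[of "a - p"]
      unfolding e_def by auto
    have wu: "w - u \<in> V"
      using u(1) BV by (intro subspace_diff[OF assms(1) insert.prems(2)]) blast
    have ce: "c *\<^sub>R e \<in> V"
      by (rule subspace_scale[OF assms(1) e(1)])
    have orth_e: "b (w - u - c *\<^sub>R e) e = 0"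
      using diff[OF wu ce e(1)] scale[OF e(1) e(1)] e(2) by (simp add: c_def)
    have orth_B: "b (w - u - c *\<^sub>R e) v = 0" if "v \<in> span B" for v
    proof -
      have "v \<in> V"
        using that BV by blast
      then show ?thesis
        using diff[OF wu ce] scale[OF e(1)] u(2)[OF that] p(2)[OF that] by (simp add: e_def)
    qed
    have "b (w - (u + c *\<^sub>R e)) v = 0" if v: "v \<in> span (insert a B)" for v
    proof -
      obtain k where "v - k *\<^sub>R a \<in> span B"
        using v span_breakdown_eq by blast
      \<comment> \<open>Since \<open>a = e + p\<close> with \<open>p\<close> in
        \<open>span B\<close>, replacing \<open>a\<close> by \<open>e\<close> changes
        \<open>v\<close> only by an element of \<open>span B\<close>.\<close>
      then have "v - k *\<^sub>R a + k *\<^sub>R p \<in> span B"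
        by (intro span_add span_scale p(1))
      then have s: "v - k *\<^sub>R e \<in> span B" (is "?s \<in> _")
        by (simp add: e_def algebra_simps)
      define z where "z = w - u - c *\<^sub>R e"
      have z: "z \<in> V"
        unfolding z_def by (rule subspace_diff[OF assms(1) wu ce])
      have ke: "k *\<^sub>R e \<in> V"
        by (rule subspace_scale[OF assms(1) e(1)])
      have sV: "?s \<in> V"
        using s BV by blast
      have vV: "v \<in> V"
        using subspace_add[OF assms(1) sV ke] by simp
      have "b z v = b ?s z + b (k *\<^sub>R e) z"
        using add[OF sV ke z] sym[OF z vV] by simp
      also have "\<dots> = b z ?s + k * b z e"
        using sym[OF z sV] scale[OF e(1) z] sym[OF z e(1)] by simp
      also have "\<dots> = 0"
        using orth_e orth_B[OF s] by (simp add: z_def)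
      finally show ?thesis
        by (simp add: z_def diff_diff_eq)
    qed
    moreover have "u + c *\<^sub>R e \<in> span (insert a B)"
      unfolding e_def using u(1) p(1) span_mono[of B "insert a B"]
      by (intro span_add span_scale span_diff) (auto intro: span_base)
    ultimately show ?thesis
      by blast
  qed
qed

lemma subspace_tangent_space: "subspace (tangent_space M q)"
proof (rule subspaceI)
  show "0 \<in> tangent_space M q"
    unfolding tangent_space_def by (simp add: zero_fun_def)
next
  fix D E
  assume "D \<in> tangent_space M q" "E \<in> tangent_space M q"
  then show "D + E \<in> tangent_space M q"
    unfolding tangent_space_def by (simp add: plus_fun_def distrib_left)
next
  fix c :: real and D
  assume "D \<in> tangent_space M q"
  then show "c *\<^sub>R D \<in> tangent_space M q"
    unfolding tangent_space_def by (simp add: scaleR_fun_def distrib_left mult.left_commute)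
qed

text \<open>A local frame evaluated at \<open>q\<close> gives \<open>B\<close>; its finiteness makes
  \<open>orthogonal_decomposition\<close> applicable to the fibre.\<close>

lemma smooth_subbundle_fibre:
  fixes M :: "('a, 'd::finite) manifold"
  assumes "smooth_subbundle M m \<H>" and "q \<in> topspace (mtop M)"
  obtains B where "finite B" and "B \<subseteq> tangent_space M q" and "\<H> q = span B"
proof -
  obtain W and X :: "nat \<Rightarrow> 'a \<Rightarrow> 'a tangent" where "q \<in> W"
    and X: "\<forall>i<m. smooth_vector_field M W (X i)"
    and span: "\<forall>r\<in>W. inj_on (\<lambda>i. X i r) {..<m} \<and> independent ((\<lambda>i. X i r) ` {..<m}) \<and>
      span ((\<lambda>i. X i r) ` {..<m}) = \<H> r"
    using bspec[OF assms(1)[unfolded smooth_subbundle_def] assms(2)] by (elim exE conjE)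
  show ?thesis
  proof
    show "(\<lambda>i. X i q) ` {..<m} \<subseteq> tangent_space M q"
      using X \<open>q \<in> W\<close> unfolding smooth_vector_field_def by auto
    show "\<H> q = span ((\<lambda>i. X i q) ` {..<m})"
      using bspec[OF span \<open>q \<in> W\<close>] by simp
  qed simp
qed

lemma metric_flat_eq:
  fixes M :: "('a, 'd::finite) manifold"
  assumes "smooth_subbundle M m \<H>"
    and "compatible_metric M \<H> h G1" and "compatible_metric M \<H> h G2"
    and "q \<in> topspace (mtop M)"
    and "orth_complement M \<H> G1 q = orth_complement M \<H> G2 q"
    and "v \<in> \<H> q"
  shows "metric_flat M G1 q v = metric_flat M G2 q v"
proof -
  obtain B where B: "finite B" "B \<subseteq> tangent_space M q" "\<H> q = span B"
    using smooth_subbundle_fibre[OF assms(1,4)] .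
  have sub: "\<H> q \<subseteq> tangent_space M q"
    unfolding B(3) by (rule span_minimal[OF B(2) subspace_tangent_space])
  have ip: "inner_product_on (tangent_space M q) (G1 q)" "inner_product_on (tangent_space M q) (G2 q)"
    using assms unfolding compatible_metric_def riemannian_metric_def smooth_fibre_metric_def
    by blast+
  have "G1 q w v = G2 q w v" if w: "w \<in> tangent_space M q" for w
  proof -
    \<comment> \<open>\<open>u\<close> is the horizontal part of \<open>w\<close> with respect to
      \<open>G1\<close>.\<close>
    obtain u where u: "u \<in> \<H> q" "\<forall>v\<in>\<H> q. G1 q (w - u) v = 0"
      using orthogonal_decomposition[OF subspace_tangent_space ip(1) B(1,2) w] B(3) by blast
    have wu: "w - u \<in> tangent_space M q"
      using u(1) sub by (intro subspace_diff[OF subspace_tangent_space w]) blast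
    then have "w - u \<in> orth_complement M \<H> G1 q"
      using u(2) unfolding orth_complement_def by simp
    \<comment> \<open>Equality of the complements makes the same remainder \<open>w - u\<close>
      orthogonal to \<open>v\<close> for \<open>G2\<close> as well.\<close>
    then have orth: "G1 q (w - u) v = 0" "G2 q (w - u) v = 0"
      using assms(5,6) unfolding orth_complement_def by auto
    have split: "b w v = b u v + b (w - u) v"
      if "inner_product_on (tangent_space M q) b" for b
    proof -
      have "b (u + (w - u)) v = b u v + b (w - u) v"
        using inner_product_on_add[OF that _ wu] u(1) assms(6) sub by (meson subsetD)
      then show ?thesis by simp
    qed
    \<comment> \<open>Both \<open>u\<close> and \<open>v\<close> are horizontal, so compatibility
      identifies the two remaining terms.\<close>
    have "G1 q u v = h q u v" "G2 q u v = h q u v"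
      using assms u(1) unfolding compatible_metric_def by blast+
    then show ?thesis
      using split[OF ip(1)] split[OF ip(2)] orth by simp
  qed
  then show ?thesis
    \<comment> \<open>Outside the tangent space both covectors have the default value 0.\<close>
    unfolding metric_flat_def by auto
qed

theorem proposition3p3:
  fixes M :: "('a, 'd::finite) manifold"
    and m :: nat
    and \<H> :: "'a \<Rightarrow> 'a tangent set"
    and h G1 G2 :: "'a \<Rightarrow> 'a tangent \<Rightarrow> 'a tangent \<Rightarrow> real"
  assumes "sub_riemannian_manifold M m \<H> h"
    and "hoermander_condition M \<H>"
    and "compatible_metric M \<H> h G1"
    and "compatible_metric M \<H> h G2"
    and "\<forall>q\<in>topspace (mtop M). orth_complement M \<H> G1 q = orth_complement M \<H> G2 q"
  shows "\<forall>f\<in>C_inf_c M. \<forall>x\<in>topspace (mtop M).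
    horizontal_sub_laplacian M \<H> h G1 f x = horizontal_sub_laplacian M \<H> h G2 f x"
proof (intro ballI)
  fix f x
  assume x: "x \<in> topspace (mtop M)"
  have "smooth_subbundle M m \<H>"
    using assms(1) unfolding sub_riemannian_manifold_def by blast
  from metric_flat_eq[OF this assms(3,4) x bspec[OF assms(5) x]]
  have "metric_flat M G1 x v = metric_flat M G2 x v" if "v \<in> unit_sphere \<H> h x" for v
    using that unfolding unit_sphere_def by simp
  \<comment> \<open>The integrands agree pointwise: on the sphere the flow starts from the same
    covector, and elsewhere the indicator is 0. Hence neither the flow nor the measure has to be
    unfolded.\<close>
  then show "horizontal_sub_laplacian M \<H> h G1 f x = horizontal_sub_laplacian M \<H> h G2 f x"
    unfolding horizontal_sub_laplacian_def set_lebesgue_integral_def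
    by (intro Bochner_Integration.integral_cong) (auto simp: indicator_def)
qed

end
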